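(* Let $n\ge 3$. If $L$ is a bifix-free regular language over a finite alphabet $\Sigma$ with $\kappa(L)=n$, then $\kappa(L^* )\le n-1$, where $L^*$ is the Kleene star of $L$. Furthermore, for every $n\ge3$ there is a subword-free language $L$ over a two-letter alphabet with $\kappa(L)=n$ that meets this bound, i.e. $\kappa(L^* )=n-1$.
   Context: For a language $L\subseteq\Sigma^*$ over a finite non-empty alphabet $\Sigma$ and a word $w\in\Sigma^*$, the (left) quotient of $L$ by $w$ is $L_w=\{x\in\Sigma^*\mid wx\in L\}$. The quotient complexity $\kappa(L)$ of a regular language $L$ is the number of distinct quotients $L_w$, $w\in\Sigma^*$; it equals the number of states of the minimal complete deterministic finite automaton accepting $L$ over $\Sigma$. The alphabet $\Sigma$ is part of the data (it may contain letters not occurring in any word of $L$). A language $L$ is prefix-free (respectively suffix-free, subword-free) if, whenever $u,v\in L$ and $u$ is a prefix (respectively suffix, subword) of $v$, then $u=v$; here "subword" means a (not necessarily contiguous) subsequence. A language is bifix-free if it is both prefix-free and suffix-free. *)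

theory Defs
  imports Main "HOL-Library.Sublist"
begin

text \<open>Words over an alphabet \<open>\<Sigma>\<close> are the elements of \<open>lists \<Sigma>\<close>.  The alphabet is an explicit
  parameter of quotients, quotient complexity and regularity, since it may contain letters that
  occur in no word of the language.\<close>

definition alphabet :: "'a set \<Rightarrow> bool" where
  "alphabet \<Sigma> \<longleftrightarrow> finite \<Sigma> \<and> \<Sigma> \<noteq> {}"

text \<open>Acceptance by a complete deterministic finite automaton.  States are taken in \<open>nat\<close>, which
  loses no generality because the state set is finite.\<close>

definition regular :: "'a set \<Rightarrow> 'a list set \<Rightarrow> bool" where
  "regular \<Sigma> L \<longleftrightarrow>
     (\<exists>(Q :: nat set) q0 \<delta> F. finite Q \<and> q0 \<in> Q \<and> F \<subseteq> Q \<and>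
        (\<forall>q\<in>Q. \<forall>a\<in>\<Sigma>. \<delta> q a \<in> Q) \<and>
        L = {w \<in> lists \<Sigma>. foldl \<delta> q0 w \<in> F})"

definition left_quotient :: "'a set \<Rightarrow> 'a list set \<Rightarrow> 'a list \<Rightarrow> 'a list set" where
  "left_quotient \<Sigma> L w = {x \<in> lists \<Sigma>. w @ x \<in> L}"

text \<open>Only meaningful for regular languages: \<open>card\<close> is \<open>0\<close> if there are infinitely many quotients.\<close>

definition quotient_complexity :: "'a set \<Rightarrow> 'a list set \<Rightarrow> nat" where
  "quotient_complexity \<Sigma> L = card (left_quotient \<Sigma> L ` lists \<Sigma>)"

definition kleene_star :: "'a list set \<Rightarrow> 'a list set" where
  "kleene_star L = concat ` lists L"

definition prefix_free :: "'a list set \<Rightarrow> bool" where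
  "prefix_free L \<longleftrightarrow> (\<forall>u\<in>L. \<forall>v\<in>L. prefix u v \<longrightarrow> u = v)"

definition suffix_free :: "'a list set \<Rightarrow> bool" where
  "suffix_free L \<longleftrightarrow> (\<forall>u\<in>L. \<forall>v\<in>L. suffix u v \<longrightarrow> u = v)"

definition bifix_free :: "'a list set \<Rightarrow> bool" where
  "bifix_free L \<longleftrightarrow> prefix_free L \<and> suffix_free L"

definition subword_free :: "'a list set \<Rightarrow> bool" where
  "subword_free L \<longleftrightarrow> (\<forall>u\<in>L. \<forall>v\<in>L. subseq u v \<longrightarrow> u = v)"

end

theory Submission
  imports Defs
begin

text \<open>A bifix-free \<open>L\<close> with at least three quotients is a prefix code without the empty word.  Strip
  from a word \<open>w\<close> its prefixes in \<open>L\<close> as long as possible: this does not change the quotient of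
  \<open>L\<^sup>*\<close> by \<open>w\<close>, and if a non-empty \<open>v\<close> remains, then the quotient is \<open>L\<^sub>v L\<^sup>*\<close>.  Here \<open>L\<^sub>v\<close> is
  neither \<open>{\<epsilon>}\<close>, because \<open>v\<close> is not in \<open>L\<close>, nor \<open>L\<close>, by suffix-freeness.  So \<open>L\<^sup>*\<close> has at most
  \<open>1 + (n - 2)\<close> quotients.  The language \<open>{a\<^bsup>n-2\<^esup>}\<close> over \<open>{a, b}\<close> attains the bound.\<close>

section \<open>Quotients and regularity\<close>

lemma left_quotient_Nil:
  "L \<subseteq> lists \<Sigma> \<Longrightarrow> left_quotient \<Sigma> L [] = L"
  by (auto simp: left_quotient_def)

lemma left_quotient_append:
  "v \<in> lists \<Sigma> \<Longrightarrow> left_quotient \<Sigma> (left_quotient \<Sigma> L u) v = left_quotient \<Sigma> L (u @ v)"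
  by (auto simp: left_quotient_def)

text \<open>This is the quotient automaton: its states are the quotients, coded by an injection
  \<open>f\<close> because \<open>regular\<close> asks for states in \<open>nat\<close>.\<close>

lemma regular_if_finite_quotients:
  assumes L: "L \<subseteq> lists \<Sigma>" and fin: "finite (left_quotient \<Sigma> L ` lists \<Sigma>)"
  shows "regular \<Sigma> L"
proof -
  let ?Q = "left_quotient \<Sigma> L ` lists \<Sigma>"
  obtain f :: "'a list set \<Rightarrow> nat" where f: "inj_on f ?Q"
    using finite_imp_inj_to_nat_seg[OF fin] by auto
  \<comment> \<open>\<open>the_inv_into\<close> decodes a state to its quotient; a transition then
    takes the quotient of that by one letter, so the state after reading \<open>w\<close> depends
    only on the quotient by \<open>w\<close>.\<close>
  define \<delta> where "\<delta> q a = f (left_quotient \<Sigma> (the_inv_into ?Q f q) [a])" for q a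
  define F where "F = f ` {K \<in> ?Q. [] \<in> K}"
  have step: "\<delta> (f (left_quotient \<Sigma> L w)) a = f (left_quotient \<Sigma> L (w @ [a]))"
    if "w \<in> lists \<Sigma>" "a \<in> \<Sigma>" for w a
    using that by (simp add: \<delta>_def the_inv_into_f_f[OF f] left_quotient_append)
  have run: "foldl \<delta> (f L) w = f (left_quotient \<Sigma> L w)" if "w \<in> lists \<Sigma>" for w
    using that by (induction w rule: rev_induct) (simp_all add: left_quotient_Nil[OF L] step)
  have "L = {w \<in> lists \<Sigma>. foldl \<delta> (f L) w \<in> F}"
  proof -
    have "f (left_quotient \<Sigma> L w) \<in> F \<longleftrightarrow> w \<in> L" if "w \<in> lists \<Sigma>" for w
    proof -
      have "f (left_quotient \<Sigma> L w) \<in> F \<longleftrightarrow> left_quotient \<Sigma> L w \<in> {K \<in> ?Q. [] \<in> K}"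
        unfolding F_def by (rule inj_on_image_mem_iff[OF f]) (use that in auto)
      then show ?thesis
        using that by (auto simp: left_quotient_def)
    qed
    with run have "foldl \<delta> (f L) w \<in> F \<longleftrightarrow> w \<in> L" if "w \<in> lists \<Sigma>" for w
      using that by presburger
    then show ?thesis
      using L by blast
  qed
  moreover have "f L \<in> f ` ?Q"
    using left_quotient_Nil[OF L] by (metis imageI lists.Nil)
  moreover have "\<forall>q\<in>f ` ?Q. \<forall>a\<in>\<Sigma>. \<delta> q a \<in> f ` ?Q"
    by (auto simp: step)
  moreover have "finite (f ` ?Q)" "F \<subseteq> f ` ?Q"
    using fin by (auto simp: F_def)
  ultimately show ?thesis
    unfolding regular_def by blast
qed

section \<open>The star of a prefix code\<close>

lemma Nil_in_kleene_star: "[] \<in> kleene_star L"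
  unfolding kleene_star_def by (rule image_eqI[of _ _ "[]"]) auto

lemma append_in_kleene_star:
  "u \<in> L \<Longrightarrow> x \<in> kleene_star L \<Longrightarrow> u @ x \<in> kleene_star L"
  unfolding kleene_star_def by (metis (no_types, lifting) concat.simps(2) imageE imageI lists.Cons)

lemma kleene_star_cases:
  assumes "w \<in> kleene_star L"
  obtains "w = []" | u x where "u \<in> L" "x \<in> kleene_star L" "w = u @ x"
proof -
  from assms obtain ws where ws: "ws \<in> lists L" "w = concat ws"
    by (auto simp: kleene_star_def)
  show thesis
  proof (cases ws)
    case Nil
    then show thesis
      using ws that(1) by simp
  next
    case (Cons u us)
    then show thesis
      using ws that(2)[of u "concat us"] by (simp add: kleene_star_def)
  qed
qed

lemma kleene_star_subset_lists:
  "L \<subseteq> lists \<Sigma> \<Longrightarrow> kleene_star L \<subseteq> lists \<Sigma>"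
  by (auto simp: kleene_star_def in_lists_conv_set subset_iff; blast)

text \<open>Any first factor \<open>v\<close> of \<open>u @ x\<close> is a prefix of the same word
  as \<open>u\<close>, so the two are comparable and prefix-freeness makes them equal.\<close>

lemma prefix_code_cancel:
  assumes "prefix_free L" "[] \<notin> L" "u \<in> L"
  shows "u @ x \<in> kleene_star L \<longleftrightarrow> x \<in> kleene_star L"
proof
  assume "u @ x \<in> kleene_star L"
  then show "x \<in> kleene_star L"
  proof (cases rule: kleene_star_cases)
    case 1
    then show ?thesis
      using assms by simp
  next
    case (2 v y)
    then have "prefix u v \<or> prefix v u"
      by (metis prefixI prefix_same_cases)
    then have "u = v"
      using assms 2 unfolding prefix_free_def by blast
    then show ?thesis
      using 2 by simp
  qed
qed (use assms append_in_kleene_star in blast)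

text \<open>The first factor of a star word \<open>v @ x\<close> is comparable with \<open>v\<close>
  but not a prefix of it. It therefore extends \<open>v\<close> to some \<open>v @ y\<close>, and
  the remaining factors form \<open>z\<close>.\<close>

lemma left_quotient_kleene_star:
  assumes L: "L \<subseteq> lists \<Sigma>" and "v \<noteq> []" "\<And>u. u \<in> L \<Longrightarrow> \<not> prefix u v"
  shows "left_quotient \<Sigma> (kleene_star L) v =
    {y @ z | y z. y \<in> left_quotient \<Sigma> L v \<and> z \<in> kleene_star L}" (is "?A = ?B")
proof (intro set_eqI iffI)
  fix x assume "x \<in> ?A"
  then have x: "x \<in> lists \<Sigma>" "v @ x \<in> kleene_star L"
    by (auto simp: left_quotient_def)
  from x(2) show "x \<in> ?B"
  proof (cases rule: kleene_star_cases)
    case 1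
    then show ?thesis
      using assms by simp
  next
    case (2 u z)
    then have "prefix v u"
      using assms(3) by (metis prefixI prefix_same_cases)
    then obtain y where y: "u = v @ y" ..
    then have "x = y @ z"
      using 2 by simp
    then show ?thesis
      using 2 y x L by (auto simp: left_quotient_def)
  qed
next
  fix x assume "x \<in> ?B"
  then obtain y z where yz: "x = y @ z" "y \<in> lists \<Sigma>" "v @ y \<in> L" "z \<in> kleene_star L"
    by (auto simp: left_quotient_def)
  then have "(v @ y) @ z \<in> kleene_star L"
    by (metis append_in_kleene_star)
  moreover have "z \<in> lists \<Sigma>"
    using yz kleene_star_subset_lists[OF L] by blast
  ultimately show "x \<in> ?A"
    using yz by (simp add: left_quotient_def)
qed

section \<open>The upper bound\<close>

lemma quotient_kleene_star_bifix_free: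
  assumes L: "L \<subseteq> lists \<Sigma>" and bf: "bifix_free L" and ne: "L \<noteq> {}" "[] \<notin> L"
    and w: "w \<in> lists \<Sigma>"
  shows "left_quotient \<Sigma> (kleene_star L) w \<in>
    insert (kleene_star L) ((\<lambda>K. {y @ z | y z. y \<in> K \<and> z \<in> kleene_star L}) `
      (left_quotient \<Sigma> L ` lists \<Sigma> - {L, {[]}}))"
  using w
proof (induction w rule: length_induct)
  case (1 w)
  consider "w = []" | u v where "w = u @ v" "u \<in> L" | "w \<noteq> []" "\<And>u. u \<in> L \<Longrightarrow> \<not> prefix u w"
    by (auto simp: prefix_def)
  then show ?case
  proof cases
    case 1
    then show ?thesis
      by (simp add: left_quotient_Nil kleene_star_subset_lists[OF L])
  next
    \<comment> \<open>Cancelling \<open>u\<close> keeps the quotient of the star, and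
      \<open>v\<close> is shorter than \<open>w\<close> because \<open>u\<close> is not
      empty.\<close>
    case (2 u v)
    then have "left_quotient \<Sigma> (kleene_star L) w = left_quotient \<Sigma> (kleene_star L) v"
      using prefix_code_cancel[of L u] bf ne(2) by (simp add: left_quotient_def bifix_free_def)
    moreover have "length v < length w" "v \<in> lists \<Sigma>"
      using 1 2 ne by auto
    ultimately show ?thesis
      using 1 by presburger
  next
    case 3
    have "w \<notin> L"
      using 3(2)[of w] by auto
    then have "[] \<notin> left_quotient \<Sigma> L w"
      by (simp add: left_quotient_def)
    then have "left_quotient \<Sigma> L w \<noteq> {[]}"
      by blast
    moreover have "left_quotient \<Sigma> L w \<noteq> L"
    proof
      assume "left_quotient \<Sigma> L w = L"
      moreover obtain x where "x \<in> L"
        using ne by blast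
      \<comment> \<open>Now \<open>x\<close> is a suffix of \<open>w @ x\<close> and both lie in
        \<open>L\<close>, so suffix-freeness would force \<open>w\<close> to be empty.\<close>
      ultimately have "w @ x \<in> L"
        by (auto simp: left_quotient_def)
      then have "x = w @ x"
        using bf \<open>x \<in> L\<close> unfolding bifix_free_def suffix_free_def by (metis suffixI)
      then show False
        using 3 by simp
    qed
    ultimately show ?thesis
      using left_quotient_kleene_star[OF L 3] 1 by blast
  qed
qed

text \<open>Finiteness is stated separately: it yields regularity of the star, and without it the
  bound could hold merely because \<open>card\<close> is 0 on infinite sets.\<close>

lemma quotient_complexity_kleene_star_bifix_free:
  assumes L: "L \<subseteq> lists \<Sigma>" and bf: "bifix_free L" and n: "quotient_complexity \<Sigma> L \<ge> 3"
  shows "finite (left_quotient \<Sigma> (kleene_star L) ` lists \<Sigma>)" (is "finite ?S")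
    and "quotient_complexity \<Sigma> (kleene_star L) \<le> quotient_complexity \<Sigma> L - 1"
proof -
  let ?Q = "left_quotient \<Sigma> L ` lists \<Sigma>"
  let ?g = "\<lambda>K. {y @ z | y z. y \<in> K \<and> z \<in> kleene_star L}"
  have card: "card ?Q \<ge> 3"
    using n by (simp add: quotient_complexity_def)
  then have fin: "finite ?Q"
    by (metis card.infinite not_numeral_le_zero)
  \<comment> \<open>The assumption of at least three quotients excludes the degenerate languages:
    \<open>{}\<close> has at most one quotient, and \<open>{[]}\<close>, the only prefix-free
    language containing \<open>[]\<close>, has at most two.\<close>
  have ne: "L \<noteq> {}"
  proof
    assume "L = {}"
    then have "?Q \<subseteq> {{}}"
      by (auto simp: left_quotient_def)
    then have "card ?Q \<le> card {{} :: 'a list set}"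
      by (rule card_mono[rotated]) simp
    then show False
      using card by simp
  qed
  have Nil: "[] \<notin> L"
  proof
    assume "[] \<in> L"
    then have "L = {[]}"
      using bf Nil_prefix unfolding bifix_free_def prefix_free_def
      by (metis insertI1 singletonD subsetI subset_antisym)
    then have "?Q \<subseteq> {{[]}, {}}"
      by (auto simp: left_quotient_def)
    then have "card ?Q \<le> card {{[]}, {} :: 'a list set}"
      by (rule card_mono[rotated]) simp
    then show False
      using card by simp
  qed
  have "L \<in> ?Q"
    using left_quotient_Nil[OF L] by (metis imageI lists.Nil)
  moreover have "{[]} \<in> ?Q"
  proof -
    obtain w where w: "w \<in> L"
      using ne by blast
    \<comment> \<open>By prefix-freeness, a word of \<open>L\<close> has no proper extension in
      \<open>L\<close>.\<close>
    have "x = []" if "w @ x \<in> L" for x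
      using bf w that unfolding bifix_free_def prefix_free_def by (metis append_self_conv prefixI)
    then have "left_quotient \<Sigma> L w = {[]}"
      using w by (auto simp: left_quotient_def)
    then show ?thesis
      using w L by (metis imageI subsetD)
  qed
  moreover have "L \<noteq> {[]}"
    using Nil by auto
  ultimately have card2: "card (?Q - {L, {[]}}) = card ?Q - 2"
    by (subst card_Diff_subset) auto
  have sub: "?S \<subseteq> insert (kleene_star L) (?g ` (?Q - {L, {[]}}))"
    using quotient_kleene_star_bifix_free[OF L bf ne Nil] by blast
  show "finite ?S"
    using sub by (rule finite_subset) (use fin in simp)
  have "card ?S \<le> card (insert (kleene_star L) (?g ` (?Q - {L, {[]}})))"
    using sub by (rule card_mono[rotated]) (use fin in simp)
  also have "\<dots> \<le> Suc (card (?g ` (?Q - {L, {[]}})))"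
    by (rule card_insert_le_m1) auto
  also have "\<dots> \<le> Suc (card ?Q - 2)"
    using card_image_le[of "?Q - {L, {[]}}" ?g] fin card2 by simp
  \<comment> \<open>Subtraction on \<open>nat\<close> is truncated, so this needs
    \<open>card ?Q\<close> to be at least 2.\<close>
  also have "\<dots> \<le> card ?Q - 1"
    using card by simp
  finally show "quotient_complexity \<Sigma> (kleene_star L) \<le> quotient_complexity \<Sigma> L - 1"
    by (simp add: quotient_complexity_def)
qed

section \<open>The witness: a single power of one letter\<close>

lemma subword_free_imp_bifix_free: "subword_free L \<Longrightarrow> bifix_free L"
  by (auto simp: subword_free_def bifix_free_def prefix_free_def suffix_free_def)

lemma kleene_star_replicate:
  "kleene_star {replicate m a} = {replicate (k * m) a | k. True}"
proof (intro set_eqI iffI)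
  fix w assume "w \<in> kleene_star {replicate m a}"
  then obtain ws where "ws \<in> lists {replicate m a}" "w = concat ws"
    by (auto simp: kleene_star_def)
  then have "w = replicate (length ws * m) a"
    by (induction ws arbitrary: w) (auto simp: replicate_add)
  then show "w \<in> {replicate (k * m) a | k. True}"
    by blast
next
  fix w assume "w \<in> {replicate (k * m) a | k. True}"
  then obtain k where "w = replicate (k * m) a"
    by blast
  moreover have "replicate (k * m) a \<in> kleene_star {replicate m a}"
    by (induction k) (auto simp: replicate_add Nil_in_kleene_star intro: append_in_kleene_star)
  ultimately show "w \<in> kleene_star {replicate m a}"
    by simp
qed

text \<open>The prefixes of the word give \<open>m + 1\<close> singleton quotients. The second
  letter \<open>b\<close> leads to the empty quotient, which is one more.\<close>

lemma quotient_complexity_replicate: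
  assumes "a \<in> \<Sigma>" "b \<in> \<Sigma>" "b \<noteq> a"
  shows "quotient_complexity \<Sigma> {replicate m a} = m + 2"
proof -
  let ?L = "{replicate m a}"
  have pow: "left_quotient \<Sigma> ?L (replicate i a) = {replicate (m - i) a}" if "i \<le> m" for i
  proof -
    have "replicate m a = replicate i a @ replicate (m - i) a"
      using that by (simp flip: replicate_add)
    then show ?thesis
      using assms by (auto simp: left_quotient_def)
  qed
  have "left_quotient \<Sigma> ?L ` lists \<Sigma> = insert {} ((\<lambda>i. {replicate i a}) ` {..m})" (is "?A = ?B")
  proof
    show "?A \<subseteq> ?B"
    proof
      fix K assume "K \<in> ?A"
      then obtain w where w: "K = left_quotient \<Sigma> ?L w"
        by blast
      show "K \<in> ?B"
      proof (cases "K = {}")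
        case False
        then obtain x where "w @ x = replicate m a"
          by (auto simp: w left_quotient_def)
        then have "w = replicate (length w) a" "length w \<le> m"
          by (metis append_eq_conv_conj length_append length_replicate le_add1 min.absorb1 take_replicate)+
        then have "K = {replicate (m - length w) a}"
          using pow w by metis
        then show ?thesis
          by simp
      qed simp
    qed
    show "?B \<subseteq> ?A"
    proof
      fix K assume "K \<in> ?B"
      then consider "K = {}" | i where "i \<le> m" "K = {replicate i a}"
        by auto
      then show "K \<in> ?A"
      proof cases
        case 1
        have "b # x \<noteq> replicate m a" for x
          using assms(3) by (cases m) auto
        then have "K = left_quotient \<Sigma> ?L [b]"
          using 1 by (auto simp: left_quotient_def)
        then show ?thesis
          using assms by auto
      next
        case (2 i)
        then have "K = left_quotient \<Sigma> ?L (replicate (m - i) a)"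
          using pow[of "m - i"] by simp
        then show ?thesis
          using assms by (auto simp: in_lists_conv_set)
      qed
    qed
  qed
  moreover have "inj_on (\<lambda>i. {replicate i a}) {..m}"
    by (auto simp: inj_on_def)
  ultimately show ?thesis
    by (auto simp: quotient_complexity_def card_image card_insert_if)
qed

text \<open>The powers of \<open>a\<close> below \<open>m\<close> give distinct nonempty quotients,
  one for each residue modulo \<open>m\<close>, and \<open>b\<close> adds the empty one. Finiteness
  is assumed so that \<open>card\<close> really counts; it comes from the upper bound.\<close>

lemma quotient_complexity_kleene_star_replicate_ge:
  assumes "a \<in> \<Sigma>" "b \<in> \<Sigma>" "b \<noteq> a" "m > 0"
    and fin: "finite (left_quotient \<Sigma> (kleene_star {replicate m a}) ` lists \<Sigma>)"
  shows "quotient_complexity \<Sigma> (kleene_star {replicate m a}) \<ge> m + 1"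
proof -
  let ?f = "left_quotient \<Sigma> (kleene_star {replicate m a})"
  have mem: "replicate j a \<in> ?f (replicate i a) \<longleftrightarrow> m dvd i + j" for i j
  proof -
    have "replicate j a \<in> ?f (replicate i a) \<longleftrightarrow> replicate (i + j) a \<in> kleene_star {replicate m a}"
      using assms by (auto simp: left_quotient_def replicate_add in_lists_conv_set)
    also have "\<dots> \<longleftrightarrow> m dvd i + j"
      by (auto simp: kleene_star_replicate dvd_def mult.commute)
    finally show ?thesis .
  qed
  have own: "replicate (m - i) a \<in> ?f (replicate i a)" if "i < m" for i
    using that by (simp add: mem)
  have inj: "inj_on (\<lambda>i. ?f (replicate i a)) {..<m}"
  proof (rule linorder_inj_onI)
    fix i j assume "i < j" "j \<in> {..<m}"
    \<comment> \<open>The word with \<open>m - i\<close> letters separates the two quotients: it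
      completes \<open>i\<close> to \<open>m\<close>, whereas \<open>j\<close> is completed to
      \<open>m + (j - i)\<close> with \<open>0 < j - i < m\<close>.\<close>
    moreover have "\<not> m dvd j + (m - i)"
    proof -
      have "\<not> m dvd m + (j - i)"
      using \<open>i < j\<close> \<open>j \<in> {..<m}\<close> nat_dvd_not_less[of "j - i" m]
      by (simp del: Nat.add_diff_assoc Nat.diff_add_assoc)
    moreover have "m + (j - i) = j + (m - i)"
      using \<open>i < j\<close> \<open>j \<in> {..<m}\<close> by auto
    ultimately show ?thesis
      by argo
  qed
  ultimately show "?f (replicate i a) \<noteq> ?f (replicate j a)"
      using own[of i] mem[of "m - i" j] by auto
  qed auto
  have "b # x \<noteq> replicate k a" for x k
    using assms(3) by (cases k) auto
  then have empty: "?f [b] = {}"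
    by (auto simp: left_quotient_def kleene_star_replicate)
  have "insert {} ((\<lambda>i. ?f (replicate i a)) ` {..<m}) \<subseteq> ?f ` lists \<Sigma>"
  proof -
    have "?f [b] \<in> ?f ` lists \<Sigma>"
      using assms by (intro imageI) auto
    then show ?thesis
      using assms(1) empty by (auto simp: in_lists_conv_set)
  qed
  then have "card (insert {} ((\<lambda>i. ?f (replicate i a)) ` {..<m})) \<le> card (?f ` lists \<Sigma>)"
    using fin by (rule card_mono[rotated])
  moreover have "{} \<notin> (\<lambda>i. ?f (replicate i a)) ` {..<m}"
    using own by force
  ultimately show ?thesis
    using card_image[OF inj] by (simp add: quotient_complexity_def)
qed

theorem theorem4:
  fixes n :: nat
  assumes "n \<ge> 3"
  shows "(\<forall>(\<Sigma> :: 'a set) L.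
            alphabet \<Sigma> \<and> L \<subseteq> lists \<Sigma> \<and> regular \<Sigma> L \<and> bifix_free L \<and>
            quotient_complexity \<Sigma> L = n \<longrightarrow>
              regular \<Sigma> (kleene_star L) \<and> quotient_complexity \<Sigma> (kleene_star L) \<le> n - 1) \<and>
         (\<exists>(\<Sigma> :: nat set) L.
            card \<Sigma> = 2 \<and> L \<subseteq> lists \<Sigma> \<and> regular \<Sigma> L \<and> subword_free L \<and>
            quotient_complexity \<Sigma> L = n \<and>
              regular \<Sigma> (kleene_star L) \<and> quotient_complexity \<Sigma> (kleene_star L) = n - 1)"
proof (intro conjI allI impI; (elim conjE)?)
  fix \<Sigma> :: "'a set" and L
  assume "L \<subseteq> lists \<Sigma>" "bifix_free L" "quotient_complexity \<Sigma> L = n"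
  note L = this
  show "regular \<Sigma> (kleene_star L)"
    using L assms by (intro regular_if_finite_quotients kleene_star_subset_lists
        quotient_complexity_kleene_star_bifix_free(1)) auto
  show "quotient_complexity \<Sigma> (kleene_star L) \<le> n - 1"
    using quotient_complexity_kleene_star_bifix_free(2)[of L \<Sigma>] L assms by simp
next
  \<comment> \<open>A power with exponent \<open>m\<close> has \<open>m + 2\<close> quotients, hence
    the exponent \<open>n - 2\<close>; it is positive since \<open>n \<ge> 3\<close>.\<close>
  define L where "L = {replicate (n - 2) (0::nat)}"
  let ?\<Sigma> = "{0, 1 :: nat}"
  have L: "L \<subseteq> lists ?\<Sigma>"
    by (auto simp: L_def in_lists_conv_set)
  have n: "quotient_complexity ?\<Sigma> L = n"
    using quotient_complexity_replicate[of 0 ?\<Sigma> 1 "n - 2"] assms by (simp add: L_def)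
  then have fin: "finite (left_quotient ?\<Sigma> L ` lists ?\<Sigma>)"
    using assms unfolding quotient_complexity_def by (intro card_ge_0_finite) simp
  have sf: "subword_free L"
    by (simp add: L_def subword_free_def)
  \<comment> \<open>The general bound applied to the witness supplies both the upper estimate and
    the finiteness that the lower estimate requires.\<close>
  note star = quotient_complexity_kleene_star_bifix_free[OF L subword_free_imp_bifix_free[OF sf]]
  have fin_star: "finite (left_quotient ?\<Sigma> (kleene_star L) ` lists ?\<Sigma>)"
    using star(1) n assms by simp
  have "quotient_complexity ?\<Sigma> (kleene_star L) \<le> n - 1"
    using star(2) n assms by simp
  moreover have "quotient_complexity ?\<Sigma> (kleene_star L) \<ge> n - 1"
    using quotient_complexity_kleene_star_replicate_ge[of 0 ?\<Sigma> 1 "n - 2"] fin_star assms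
    by (simp add: L_def)
  ultimately have "quotient_complexity ?\<Sigma> (kleene_star L) = n - 1"
    by simp
  moreover have "card ?\<Sigma> = 2"
    by simp
  ultimately show "\<exists>(\<Sigma> :: nat set) L.
            card \<Sigma> = 2 \<and> L \<subseteq> lists \<Sigma> \<and> regular \<Sigma> L \<and> subword_free L \<and>
            quotient_complexity \<Sigma> L = n \<and>
              regular \<Sigma> (kleene_star L) \<and> quotient_complexity \<Sigma> (kleene_star L) = n - 1"
    using L n sf regular_if_finite_quotients[OF L fin]
      regular_if_finite_quotients[OF kleene_star_subset_lists[OF L] fin_star]
    by blast
qed

end
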